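(* Let $\phi$ be an automorphism of the open unit disk $\mathbb{D}$ (i.e. a bijective analytic map $\mathbb{D}\to\mathbb{D}$). Then the composition operator $C_\phi$ on $H^2(\mathbb{D})$ is 2-complex symmetric with $J$ if and only if $C_\phi$ is normal.
   Context: $H^2(\mathbb{D})$ is the Hardy space of analytic functions $f$ on the open unit disk $\mathbb{D}\subset\mathbb{C}$ with $\|f\|^2=\sup_{0<r<1}\frac{1}{2\pi}\int_0^{2\pi}|f(re^{i\theta})|^2d\theta<\infty$, a Hilbert space. For an analytic self-map $\phi$ of $\mathbb{D}$, the composition operator $C_\phi$ is the bounded operator on $H^2(\mathbb{D})$ given by $C_\phi f=f\circ\phi$. $J$ is the conjugation on $H^2(\mathbb{D})$ given by $(Jf)(z)=\overline{f(\bar z)}$. A bounded linear operator $T$ on $H^2(\mathbb{D})$ is said to be 2-complex symmetric with $J$ if $JT^2J-2T^*JTJ+(T^* )^2=0$ (equivalently $JT^2-2T^*JT+(T^* )^2J=0$). *)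

theory Defs
  imports "HOL-Complex_Analysis.Complex_Analysis"
begin

abbreviation unit_disk :: "complex set" ("\<bbbD>")
  where "\<bbbD> \<equiv> ball 0 1"

definition disk_automorphism :: "(complex \<Rightarrow> complex) \<Rightarrow> bool"
  where "disk_automorphism \<phi> \<longleftrightarrow> \<phi> holomorphic_on \<bbbD> \<and> bij_betw \<phi> \<bbbD> \<bbbD>"

definition circle_mean_sq :: "(complex \<Rightarrow> complex) \<Rightarrow> real \<Rightarrow> real"
  where "circle_mean_sq f r =
    1 / (2 * pi) * integral {0..2 * pi} (\<lambda>\<theta>. (cmod (f (of_real r * cis \<theta>)))\<^sup>2)"

text \<open>A function on the disk is represented by its extension by zero to the whole plane, so that
  equality of elements of the Hardy space is equality of functions.\<close>

definition H2 :: "(complex \<Rightarrow> complex) set"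
  where "H2 = {f. f holomorphic_on \<bbbD> \<and> (\<forall>z. z \<notin> \<bbbD> \<longrightarrow> f z = 0) \<and>
                  bdd_above (circle_mean_sq f ` {0<..<1})}"

definition H2_norm :: "(complex \<Rightarrow> complex) \<Rightarrow> real"
  where "H2_norm f = sqrt (SUP r\<in>{0<..<1}. circle_mean_sq f r)"

text \<open>The inner product inducing the norm, recovered by polarization; it is linear in the first
  argument and conjugate linear in the second.\<close>

definition H2_inner :: "(complex \<Rightarrow> complex) \<Rightarrow> (complex \<Rightarrow> complex) \<Rightarrow> complex"
  where "H2_inner f g =
    (of_real ((H2_norm (\<lambda>z. f z + g z))\<^sup>2) - of_real ((H2_norm (\<lambda>z. f z - g z))\<^sup>2)
     + \<i> * of_real ((H2_norm (\<lambda>z. f z + \<i> * g z))\<^sup>2)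
     - \<i> * of_real ((H2_norm (\<lambda>z. f z - \<i> * g z))\<^sup>2)) / 4"

type_synonym H2_op = "(complex \<Rightarrow> complex) \<Rightarrow> (complex \<Rightarrow> complex)"

text \<open>Operators are only meaningful on \<open>H2\<close>; their values elsewhere are irrelevant.\<close>

definition bounded_op :: "H2_op \<Rightarrow> bool"
  where "bounded_op T \<longleftrightarrow>
    (\<forall>f\<in>H2. T f \<in> H2) \<and>
    (\<forall>f\<in>H2. \<forall>g\<in>H2. T (\<lambda>z. f z + g z) = (\<lambda>z. T f z + T g z)) \<and>
    (\<forall>c. \<forall>f\<in>H2. T (\<lambda>z. c * f z) = (\<lambda>z. c * T f z)) \<and>
    (\<exists>K. \<forall>f\<in>H2. H2_norm (T f) \<le> K * H2_norm f)"

definition adjoint_op :: "H2_op \<Rightarrow> H2_op"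
  where "adjoint_op T g = (THE h. h \<in> H2 \<and> (\<forall>f\<in>H2. H2_inner (T f) g = H2_inner f h))"

definition normal_op :: "H2_op \<Rightarrow> bool"
  where "normal_op T \<longleftrightarrow>
    bounded_op T \<and> (\<forall>f\<in>H2. T (adjoint_op T f) = adjoint_op T (T f))"

definition J :: H2_op
  where "J f = (\<lambda>z. cnj (f (cnj z)))"

definition two_complex_symmetric_J :: "H2_op \<Rightarrow> bool"
  where "two_complex_symmetric_J T \<longleftrightarrow>
    bounded_op T \<and>
    (\<forall>f\<in>H2. (\<lambda>z. J (T (T (J f))) z - 2 * adjoint_op T (J (T (J f))) z
                    + adjoint_op T (adjoint_op T f) z) = (\<lambda>z. 0))"

definition composition_op :: "(complex \<Rightarrow> complex) \<Rightarrow> H2_op"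
  where "composition_op \<phi> f = (\<lambda>z. if z \<in> \<bbbD> then f (\<phi> z) else 0)"

end

theory Submission
  imports Defs
begin

text \<open>The adjoint of the composition operator sends the reproducing kernel at \<open>w\<close> to the kernel at
  \<open>\<phi> w\<close>. Both properties are tested on the constant \<open>1\<close>, the kernel at \<open>0\<close>. With \<open>a = \<phi> 0\<close> and
  \<open>b = \<phi> a\<close>, symmetry gives \<open>K\<^sub>0 - 2 K\<^sub>a + K\<^sub>b = 0\<close> and normality gives \<open>K\<^sub>a \<circ> \<phi> = K\<^sub>a\<close>; either one
  forces \<open>a = 0\<close>. Then \<open>\<phi>\<close> is a rotation by the Schwarz lemma, and a rotation induces a diagonal
  unitary operator, which has both properties.\<close>

subsection \<open>Power series and the norm\<close>

text \<open>A relation rather than a coefficient function, so that coefficients of sums, kernels and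
  rotated functions can be exhibited directly instead of being computed as derivatives.\<close>

definition expands :: "(nat \<Rightarrow> complex) \<Rightarrow> (complex \<Rightarrow> complex) \<Rightarrow> bool"
  where "expands a f \<longleftrightarrow> (\<forall>z\<in>\<bbbD>. (\<lambda>n. a n * z ^ n) sums f z)"

lemma expands_add: "expands a f \<Longrightarrow> expands b g \<Longrightarrow> expands (\<lambda>n. a n + b n) (\<lambda>z. f z + g z)"
  by (auto simp: expands_def distrib_right intro: sums_add)

lemma expands_cmult: "expands a f \<Longrightarrow> expands (\<lambda>n. c * a n) (\<lambda>z. c * f z)"
  by (auto simp: expands_def mult.assoc intro: sums_mult)

lemma expands_holomorphic: "expands a f \<Longrightarrow> f holomorphic_on \<bbbD>"
  by (rule power_series_holomorphic[where a = a]) (auto simp: expands_def)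

lemma holomorphic_expands:
  assumes "f holomorphic_on \<bbbD>"
  obtains a where "expands a f"
  proof
  show "expands (\<lambda>n. (deriv ^^ n) f 0 / fact n) f"
    using holomorphic_power_series[OF assms] by (simp add: expands_def)
qed

section \<open>Parseval's identity on circles inside the disk\<close>

lemma has_integral_cis_mult:
  "((\<lambda>\<theta>. cis \<theta> ^ m * cnj (cis \<theta> ^ n)) has_integral (if m = n then 2 * pi else 0)) {0..2*pi}"
proof (cases "m = n")
  case True
  have "(\<lambda>\<theta>. cis \<theta> ^ m * cnj (cis \<theta> ^ n)) = (\<lambda>\<theta>. 1)"
    using True by (simp add: cis_cnj cis_mult flip: power_mult_distrib)
  moreover have "((\<lambda>\<theta>. 1::complex) has_integral (2 * pi)) {0..2*pi}"
    using has_integral_const_real[of "1::complex" 0 "2*pi"] by (simp add: scaleR_conv_of_real)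
  ultimately show ?thesis
    using True by simp
next
  case False
  define k :: complex where "k = \<i> * (of_nat m - of_nat n)"
  have k: "k \<noteq> 0"
    using False by (simp add: k_def)
  have eq: "cis \<theta> ^ m * cnj (cis \<theta> ^ n) = exp (k * of_real \<theta>)" for \<theta>
  proof -
    have "cis \<theta> ^ m * cnj (cis \<theta> ^ n) = cis (of_nat m * \<theta> - of_nat n * \<theta>)"
      by (simp add: Complex.DeMoivre cis_cnj cis_mult del: complex_cnj_power)
    then show ?thesis
      by (simp add: k_def cis_conv_exp algebra_simps)
  qed
  have "((\<lambda>\<theta>. exp (k * of_real \<theta>)) has_integral
          (exp (k * of_real (2 * pi)) / k - exp (k * of_real 0) / k)) {0..2*pi}"
  proof (rule fundamental_theorem_of_calculus)
    fix x :: real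
    show "((\<lambda>\<theta>. exp (k * of_real \<theta>) / k) has_vector_derivative exp (k * of_real x))
            (at x within {0..2*pi})"
      by (rule has_vector_derivative_real_field) (use k in \<open>auto intro!: derivative_eq_intros\<close>)
  qed simp
  \<comment> \<open>The primitive is periodic, so its values at the two endpoints cancel.\<close>
  moreover have "exp (k * of_real (2 * pi)) = 1"
    unfolding exp_eq_1 by (auto simp: k_def intro!: exI[of _ "int m - int n"])
  ultimately show ?thesis
    using False by (simp add: eq del: complex_cnj_power)
qed

text \<open>The Taylor partial sums converge uniformly on the circle, so the integral of the squared
  modulus passes to the limit, and orthogonality removes the cross terms of each partial
  sum.\<close>

lemma circle_mean_sq_sums:
  assumes "expands a f" "0 < r" "r < 1"
  shows "(\<lambda>n. (cmod (a n))\<^sup>2 * r ^ (2 * n)) sums circle_mean_sq f r"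
proof -
  define p where "p = (\<lambda>N \<theta>. \<Sum>n<N. a n * (of_real r * cis \<theta>) ^ n)"
  define F where "F = (\<lambda>\<theta>. f (of_real r * cis \<theta>))"
  have inD: "of_real r * cis \<theta> \<in> \<bbbD>" for \<theta>
    using assms by (simp add: norm_mult)
  \<comment> \<open>Convergence at a radius beyond \<open>r\<close> gives absolute convergence at
    \<open>r\<close>, which is the majorant for the Weierstrass test.\<close>
  obtain s where s: "r < s" "s < 1"
    using assms dense by blast
  have "summable (\<lambda>n. a n * (of_real s) ^ n)"
    using assms s by (auto simp: expands_def sums_iff)
  then have "summable (\<lambda>n. norm (a n * (of_real r) ^ n))"
    by (rule powser_insidea[where x = "of_real s"]) (use assms s in auto)
  then have "uniform_limit {0..2*pi} p (\<lambda>\<theta>. \<Sum>n. a n * (of_real r * cis \<theta>) ^ n) sequentially"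
    unfolding p_def
    by (rule Weierstrass_m_test[rotated]) (use assms in \<open>auto simp: norm_mult norm_power\<close>)
  moreover have "(\<Sum>n. a n * (of_real r * cis \<theta>) ^ n) = F \<theta>" for \<theta>
    using assms(1) inD[of \<theta>] by (auto simp: expands_def F_def sums_iff)
  ultimately have u: "uniform_limit {0..2*pi} p F sequentially"
    by simp
  have cp: "continuous_on {0..2*pi} (p N)" for N
    unfolding p_def cis_conv_exp by (intro continuous_intros)
  have "continuous_on {0..2*pi} F"
    by (rule uniform_limit_theorem[OF _ u]) (auto intro!: always_eventually cp)
  then have bF: "bounded (F ` {0..2*pi})"
    by (intro compact_imp_bounded compact_continuous_image) auto
  have "uniform_limit {0..2*pi} (\<lambda>N \<theta>. p N \<theta> * cnj (p N \<theta>)) (\<lambda>\<theta>. F \<theta> * cnj (F \<theta>)) sequentially"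
  proof (rule uniform_lim_mult)
    show "bounded ((\<lambda>\<theta>. cnj (F \<theta>)) ` {0..2*pi})"
      using bF by (auto simp: bounded_iff)
  qed (auto intro!: uniform_limit_intros u bF)
  then obtain I L where I: "\<And>N. ((\<lambda>\<theta>. p N \<theta> * cnj (p N \<theta>)) has_integral I N) {0..2*pi}"
    and L: "((\<lambda>\<theta>. F \<theta> * cnj (F \<theta>)) has_integral L) {0..2*pi}"
    and IL: "I \<longlonglongrightarrow> L"
    by (rule uniform_limit_integral) (auto intro!: continuous_intros cp)
  have "I N = of_real (2 * pi * (\<Sum>n<N. (cmod (a n))\<^sup>2 * r ^ (2 * n)))" for N
  proof -
    have "((\<lambda>\<theta>. \<Sum>m<N. \<Sum>n<N. (a m * of_real r ^ m * cnj (a n * of_real r ^ n))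
             * (cis \<theta> ^ m * cnj (cis \<theta> ^ n))) has_integral
           (\<Sum>m<N. \<Sum>n<N. (a m * of_real r ^ m * cnj (a n * of_real r ^ n))
             * (if m = n then 2 * pi else 0))) {0..2*pi}"
      by (intro has_integral_sum has_integral_mult_right has_integral_cis_mult) auto
    moreover have "(\<lambda>\<theta>. \<Sum>m<N. \<Sum>n<N. (a m * of_real r ^ m * cnj (a n * of_real r ^ n))
             * (cis \<theta> ^ m * cnj (cis \<theta> ^ n))) = (\<lambda>\<theta>. p N \<theta> * cnj (p N \<theta>))"
      by (simp add: p_def sum_product power_mult_distrib mult_ac)
    ultimately have "I N = (\<Sum>m<N. \<Sum>n<N. (a m * of_real r ^ m * cnj (a n * of_real r ^ n))
             * (if m = n then 2 * pi else 0))"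
      using has_integral_unique[OF I[of N]] by simp
    also have "\<dots> = (\<Sum>m<N. (a m * of_real r ^ m * cnj (a m * of_real r ^ m)) * (2 * pi))"
      by (rule sum.cong) (simp_all add: if_distrib[of of_real] if_distrib[of "(*) _"] cong: if_cong)
    also have "\<dots> = (\<Sum>m<N. of_real (2 * pi * ((cmod (a m))\<^sup>2 * r ^ (2 * m))))"
      using assms by (intro sum.cong refl)
        (simp add: complex_norm_square[symmetric] norm_mult norm_power power_mult_distrib power_mult
           power_even_eq mult_ac del: complex_cnj_mult)
    finally show ?thesis
      by (simp add: sum_distrib_left)
  qed
  \<comment> \<open>The integrals so far are complex valued; real parts lead back to the real
    integral in \<open>circle_mean_sq\<close>.\<close>
  then have "(\<lambda>N. Re (of_real (2 * pi * (\<Sum>n<N. (cmod (a n))\<^sup>2 * r ^ (2 * n))))) \<longlonglongrightarrow> Re L"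
    using tendsto_Re[OF IL] by simp
  then have "(\<lambda>N. 1 / (2 * pi) * (2 * pi * (\<Sum>n<N. (cmod (a n))\<^sup>2 * r ^ (2 * n))))
      \<longlonglongrightarrow> 1 / (2 * pi) * Re L"
    by (intro tendsto_mult_left) simp
  moreover have "((\<lambda>\<theta>. (cmod (F \<theta>))\<^sup>2) has_integral Re L) {0..2*pi}"
    using has_integral_linear[OF L bounded_linear_Re]
    by (simp add: o_def complex_norm_square[symmetric])
  then have "circle_mean_sq f r = 1 / (2 * pi) * Re L"
    unfolding circle_mean_sq_def F_def by (simp add: integral_unique)
  ultimately show ?thesis
    by (simp add: sums_def)
qed

section \<open>The Hardy norm as the square-sum norm of the coefficients\<close>

lemma circle_mean_sq_bdd_summable:
  assumes "expands a f" "bdd_above (circle_mean_sq f ` {0<..<1})"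
  shows "summable (\<lambda>n. (cmod (a n))\<^sup>2)"
    and "(\<Sum>n. (cmod (a n))\<^sup>2) \<le> (SUP r\<in>{0<..<1}. circle_mean_sq f r)"
proof -
  let ?B = "SUP r\<in>{0<..<1}. circle_mean_sq f r"
  \<comment> \<open>With \<open>N\<close> fixed, the truncated Parseval sum is a polynomial in
    \<open>r\<close>, hence continuous at 1, and for every \<open>r\<close> below 1 it is at most
    the full sum, so at most the supremum. Let \<open>r\<close> tend to 1.\<close>
  have le: "(\<Sum>n<N. (cmod (a n))\<^sup>2) \<le> ?B" for N
  proof (rule tendsto_upperbound)
    show "((\<lambda>r. \<Sum>n<N. (cmod (a n))\<^sup>2 * r ^ (2 * n)) \<longlongrightarrow> (\<Sum>n<N. (cmod (a n))\<^sup>2)) (at_left 1)"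
      by (rule tendsto_eq_intros tendsto_ident_at refl | simp)+
    have "\<forall>\<^sub>F r in at_left (1::real). r \<in> {0<..<1}"
      by (rule eventually_at_left_real) simp
    then show "\<forall>\<^sub>F r in at_left 1. (\<Sum>n<N. (cmod (a n))\<^sup>2 * r ^ (2 * n)) \<le> ?B"
    proof eventually_elim
      case (elim r)
      then have s: "(\<lambda>n. (cmod (a n))\<^sup>2 * r ^ (2 * n)) sums circle_mean_sq f r"
        by (intro circle_mean_sq_sums assms) auto
      have "(\<Sum>n<N. (cmod (a n))\<^sup>2 * r ^ (2 * n)) \<le> circle_mean_sq f r"
        using s elim sum_le_suminf[of "\<lambda>n. (cmod (a n))\<^sup>2 * r ^ (2 * n)" "{..<N}"]
        by (simp add: sums_iff)
      also have "\<dots> \<le> ?B"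
        using elim by (intro cSUP_upper assms(2))
      finally show ?case .
    qed
  qed simp
  show sm: "summable (\<lambda>n. (cmod (a n))\<^sup>2)"
    by (rule summableI_nonneg_bounded[OF _ le]) simp
  show "(\<Sum>n. (cmod (a n))\<^sup>2) \<le> ?B"
    by (rule suminf_le_const[OF sm le])
qed

lemma circle_mean_sq_le:
  assumes "expands a f" "summable (\<lambda>n. (cmod (a n))\<^sup>2)" "0 < r" "r < 1"
  shows "circle_mean_sq f r \<le> (\<Sum>n. (cmod (a n))\<^sup>2)"
proof -
  have s: "(\<lambda>n. (cmod (a n))\<^sup>2 * r ^ (2 * n)) sums circle_mean_sq f r"
    by (rule circle_mean_sq_sums) fact+
  have "(\<Sum>n. (cmod (a n))\<^sup>2 * r ^ (2 * n)) \<le> (\<Sum>n. (cmod (a n))\<^sup>2)"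
    using s assms by (intro suminf_le) (auto simp: sums_iff mult_left_le power_le_one)
  then show ?thesis
    using s by (simp add: sums_iff)
qed

lemma H2_iff:
  assumes "expands a f"
  shows "f \<in> H2 \<longleftrightarrow> (\<forall>z. z \<notin> \<bbbD> \<longrightarrow> f z = 0) \<and> summable (\<lambda>n. (cmod (a n))\<^sup>2)"
proof -
  have "bdd_above (circle_mean_sq f ` {0<..<1})" if "summable (\<lambda>n. (cmod (a n))\<^sup>2)"
    by (rule bdd_aboveI[of _ "\<Sum>n. (cmod (a n))\<^sup>2"])
      (use circle_mean_sq_le[OF assms that] in auto)
  with circle_mean_sq_bdd_summable(1)[OF assms]
  have "bdd_above (circle_mean_sq f ` {0<..<1}) \<longleftrightarrow> summable (\<lambda>n. (cmod (a n))\<^sup>2)"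
    by (rule iffI)
  then show ?thesis
    using expands_holomorphic[OF assms] by (simp add: H2_def)
qed

lemma H2_expands:
  assumes "f \<in> H2"
  obtains a where "expands a f" "summable (\<lambda>n. (cmod (a n))\<^sup>2)"
proof -
  have "f holomorphic_on \<bbbD>"
    using assms by (simp add: H2_def)
  then obtain a where "expands a f"
    by (rule holomorphic_expands)
  with assms that show ?thesis
    by (simp add: H2_iff)
qed

lemma H2_norm_sums:
  assumes "expands a f" "summable (\<lambda>n. (cmod (a n))\<^sup>2)"
  shows "(\<lambda>n. (cmod (a n))\<^sup>2) sums (H2_norm f)\<^sup>2"
proof -
  have bdd: "bdd_above (circle_mean_sq f ` {0<..<1})"
    by (rule bdd_aboveI[of _ "\<Sum>n. (cmod (a n))\<^sup>2"]) (use circle_mean_sq_le[OF assms] in auto)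
  have "(SUP r\<in>{0<..<1}. circle_mean_sq f r) = (\<Sum>n. (cmod (a n))\<^sup>2)"
  proof (rule antisym)
    show "(SUP r\<in>{0<..<1}. circle_mean_sq f r) \<le> (\<Sum>n. (cmod (a n))\<^sup>2)"
      by (rule cSUP_least) (use circle_mean_sq_le[OF assms] in auto)
  qed (rule circle_mean_sq_bdd_summable(2)[OF assms(1) bdd])
  then show ?thesis
    using assms(2) by (simp add: H2_norm_def sums_iff suminf_nonneg)
qed

text \<open>Keeps the coefficients of \<open>f + c * g\<close> square-summable in the polarization
  formula.\<close>

lemma summable_sq_add:
  assumes "summable (\<lambda>n. (cmod (a n))\<^sup>2)" "summable (\<lambda>n. (cmod (b n))\<^sup>2)"
  shows "summable (\<lambda>n. (cmod (a n + b n))\<^sup>2)"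
proof (rule summable_comparison_test)
  show "summable (\<lambda>n. 2 * (cmod (a n))\<^sup>2 + 2 * (cmod (b n))\<^sup>2)"
    by (intro summable_add summable_mult assms)
  have "(cmod (a n + b n))\<^sup>2 \<le> 2 * (cmod (a n))\<^sup>2 + 2 * (cmod (b n))\<^sup>2" for n
  proof -
    have "(cmod (a n + b n))\<^sup>2 \<le> (cmod (a n) + cmod (b n))\<^sup>2"
      by (simp add: norm_triangle_ineq power_mono)
    also have "\<dots> \<le> 2 * (cmod (a n))\<^sup>2 + 2 * (cmod (b n))\<^sup>2"
      using zero_le_power2[of "cmod (a n) - cmod (b n)"] by (simp add: power2_sum power2_diff)
    finally show ?thesis .
  qed
  then show "\<exists>N. \<forall>n\<ge>N. norm ((cmod (a n + b n))\<^sup>2) \<le> 2 * (cmod (a n))\<^sup>2 + 2 * (cmod (b n))\<^sup>2"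
    by simp
qed

text \<open>Each of the four squared norms is a sum over coefficients, so the polarization identity
  for complex numbers can be applied term by term.\<close>

lemma H2_inner_sums:
  assumes a: "expands a f" "summable (\<lambda>n. (cmod (a n))\<^sup>2)"
    and b: "expands b g" "summable (\<lambda>n. (cmod (b n))\<^sup>2)"
  shows "(\<lambda>n. a n * cnj (b n)) sums H2_inner f g"
proof -
  have *: "(\<lambda>n. complex_of_real ((cmod (a n + c * b n))\<^sup>2))
             sums of_real ((H2_norm (\<lambda>z. f z + c * g z))\<^sup>2)" for c
  proof (intro sums_of_real H2_norm_sums expands_add expands_cmult a b summable_sq_add)
    show "summable (\<lambda>n. (cmod (c * b n))\<^sup>2)"
      using b(2) by (auto simp: norm_mult power_mult_distrib intro: summable_mult)
  qed
  have "(\<lambda>n. (of_real ((cmod (a n + 1 * b n))\<^sup>2) - of_real ((cmod (a n + -1 * b n))\<^sup>2)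
            + \<i> * of_real ((cmod (a n + \<i> * b n))\<^sup>2)
            - \<i> * of_real ((cmod (a n + (-\<i>) * b n))\<^sup>2)) / 4) sums
        ((of_real ((H2_norm (\<lambda>z. f z + 1 * g z))\<^sup>2) - of_real ((H2_norm (\<lambda>z. f z + -1 * g z))\<^sup>2)
     + \<i> * of_real ((H2_norm (\<lambda>z. f z + \<i> * g z))\<^sup>2)
     - \<i> * of_real ((H2_norm (\<lambda>z. f z + (-\<i>) * g z))\<^sup>2)) / 4)"
    by (intro sums_divide sums_add sums_diff sums_mult *)
  moreover have "(of_real ((cmod (x + 1 * y))\<^sup>2) - of_real ((cmod (x + -1 * y))\<^sup>2)
            + \<i> * of_real ((cmod (x + \<i> * y))\<^sup>2)
            - \<i> * of_real ((cmod (x + (-\<i>) * y))\<^sup>2)) / 4 = x * cnj y" for x y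
    by (simp only: complex_norm_square) (simp add: algebra_simps)
  ultimately show ?thesis
    by (simp add: H2_inner_def)
qed

subsection \<open>The reproducing kernel\<close>

text \<open>The Szego kernel, cut off to zero outside the disk as the encoding of \<open>H2\<close>
  requires.\<close>

definition kernel :: "complex \<Rightarrow> complex \<Rightarrow> complex"
  where "kernel w z = (if z \<in> \<bbbD> then 1 / (1 - cnj w * z) else 0)"

lemma kernel_expands:
  assumes "w \<in> \<bbbD>"
  shows "expands (\<lambda>n. cnj w ^ n) (kernel w)" "summable (\<lambda>n. (cmod (cnj w ^ n))\<^sup>2)"
proof -
  have "cmod (cnj w * z) < 1" if "z \<in> \<bbbD>" for z
    using assms that mult_strict_mono[of "cmod w" 1 "cmod z" 1] by (simp add: norm_mult)
  then show "expands (\<lambda>n. cnj w ^ n) (kernel w)"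
    using geometric_sums[of "cnj w * z" for z]
    by (simp add: expands_def kernel_def power_mult_distrib)
  have "summable (\<lambda>n. ((cmod w)\<^sup>2) ^ n)"
    using assms by (intro summable_geometric) (simp add: power_less_one_iff)
  then show "summable (\<lambda>n. (cmod (cnj w ^ n))\<^sup>2)"
    by (simp add: norm_power mult.commute flip: power_mult)
qed

lemma kernel_in_H2: "w \<in> \<bbbD> \<Longrightarrow> kernel w \<in> H2"
  using kernel_expands[of w] by (auto simp: H2_iff kernel_def)

text \<open>The kernel has coefficients \<open>cnj w ^ n\<close>, so pairing with it reproduces the
  power series of \<open>f\<close> at \<open>w\<close>.\<close>

lemma H2_inner_kernel_right:
  assumes "f \<in> H2" "w \<in> \<bbbD>"
  shows "H2_inner f (kernel w) = f w"
proof -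
  obtain a where a: "expands a f" "summable (\<lambda>n. (cmod (a n))\<^sup>2)"
    using H2_expands assms(1) .
  have "(\<lambda>n. a n * w ^ n) sums H2_inner f (kernel w)"
    using H2_inner_sums[OF a kernel_expands[OF assms(2)]] by simp
  moreover have "(\<lambda>n. a n * w ^ n) sums f w"
    using a assms(2) by (simp add: expands_def)
  ultimately show ?thesis
    by (rule sums_unique2)
qed

lemma H2_inner_kernel_left:
  assumes "f \<in> H2" "w \<in> \<bbbD>"
  shows "H2_inner (kernel w) f = cnj (f w)"
proof -
  obtain a where a: "expands a f" "summable (\<lambda>n. (cmod (a n))\<^sup>2)"
    using H2_expands assms(1) .
  have "(\<lambda>n. cnj w ^ n * cnj (a n)) sums H2_inner (kernel w) f"
    by (rule H2_inner_sums[OF kernel_expands[OF assms(2)] a])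
  moreover have "(\<lambda>n. cnj (a n * w ^ n)) sums cnj (f w)"
    using a assms(2) by (simp only: expands_def sums_cnj)
  ultimately show ?thesis
    by (simp add: mult.commute sums_unique2)
qed

text \<open>Uniqueness for the definite description: testing against kernels determines the value at
  every point of the disk, and elements of \<open>H2\<close> vanish elsewhere. Existence comes from
  an explicit candidate \<open>h\<close>.\<close>

lemma adjoint_op_eqI:
  assumes "h \<in> H2" "\<And>f. f \<in> H2 \<Longrightarrow> H2_inner (T f) g = H2_inner f h"
  shows "adjoint_op T g = h"
  unfolding adjoint_op_def
proof (rule the_equality)
  fix k assume k: "k \<in> H2 \<and> (\<forall>f\<in>H2. H2_inner (T f) g = H2_inner f k)"
  show "k = h"
  proof
    fix w
    show "k w = h w"
    proof (cases "w \<in> \<bbbD>")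
      case True
      then have "H2_inner (kernel w) k = H2_inner (kernel w) h"
        using k assms kernel_in_H2 by metis
      then show ?thesis
        using True k assms(1) by (simp add: H2_inner_kernel_left)
    next
      case False
      then show ?thesis
        using k assms(1) by (auto simp: H2_def)
    qed
  qed
qed (use assms in blast)

text \<open>By the reproducing property both pairings equal \<open>f (\<phi> w)\<close>; boundedness
  keeps \<open>composition_op \<phi> f\<close> inside \<open>H2\<close>.\<close>

lemma adjoint_op_composition_kernel:
  assumes "bounded_op (composition_op \<phi>)" "\<phi> ` \<bbbD> \<subseteq> \<bbbD>" "w \<in> \<bbbD>"
  shows "adjoint_op (composition_op \<phi>) (kernel w) = kernel (\<phi> w)"
proof (rule adjoint_op_eqI)
  have \<phi>w: "\<phi> w \<in> \<bbbD>"
    using assms(2,3) by blast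
  then show "kernel (\<phi> w) \<in> H2"
    by (rule kernel_in_H2)
  fix f assume f: "f \<in> H2"
  then have "composition_op \<phi> f \<in> H2"
    using assms(1) by (simp add: bounded_op_def)
  then have "H2_inner (composition_op \<phi> f) (kernel w) = f (\<phi> w)"
    using assms(3) by (simp add: H2_inner_kernel_right composition_op_def)
  then show "H2_inner (composition_op \<phi> f) (kernel w) = H2_inner f (kernel (\<phi> w))"
    using f \<phi>w by (simp add: H2_inner_kernel_right)
qed

subsection \<open>Symmetry or normality forces a fixed point at the origin\<close>

lemma composition_op_kernel_0:
  assumes "\<phi> ` \<bbbD> \<subseteq> \<bbbD>"
  shows "composition_op \<phi> (kernel 0) = kernel 0"
  using assms by (auto simp: composition_op_def kernel_def fun_eq_iff image_subset_iff)

lemma J_kernel_0: "J (kernel 0) = kernel 0"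
  by (auto simp: J_def kernel_def fun_eq_iff)

lemma normal_fixes_0:
  assumes "normal_op (composition_op \<phi>)" "\<phi> ` \<bbbD> \<subseteq> \<bbbD>"
  shows "\<phi> 0 = 0"
proof -
  let ?T = "composition_op \<phi>"
  have bd: "bounded_op ?T"
    and N: "?T (adjoint_op ?T (kernel 0)) = adjoint_op ?T (?T (kernel 0))"
    using assms(1) kernel_in_H2[of 0] by (auto simp: normal_op_def)
  have 0: "\<phi> 0 \<in> \<bbbD>"
    using assms(2) by force
  have "?T (kernel (\<phi> 0)) = kernel (\<phi> 0)"
    using N adjoint_op_composition_kernel[OF bd assms(2), of 0]
      composition_op_kernel_0[OF assms(2)] by simp
  \<comment> \<open>At the origin the left side is the kernel at \<open>\<phi> 0\<close> evaluated
    at its own base point, which exceeds 1 unless that point is 0.\<close>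
  then have "?T (kernel (\<phi> 0)) 0 = kernel (\<phi> 0) 0"
    by simp
  then have "1 / (1 - cnj (\<phi> 0) * \<phi> 0) = 1"
    using 0 by (simp add: composition_op_def kernel_def)
  then show ?thesis
    by (auto simp: divide_eq_1_iff)
qed

lemma two_complex_symmetric_fixes_0:
  assumes "two_complex_symmetric_J (composition_op \<phi>)" "\<phi> ` \<bbbD> \<subseteq> \<bbbD>"
  shows "\<phi> 0 = 0"
proof -
  let ?T = "composition_op \<phi>"
  have bd: "bounded_op ?T"
    and S: "(\<lambda>z. J (?T (?T (J (kernel 0)))) z - 2 * adjoint_op ?T (J (?T (J (kernel 0)))) z
              + adjoint_op ?T (adjoint_op ?T (kernel 0)) z) = (\<lambda>z. 0)"
    using assms(1) kernel_in_H2[of 0] by (auto simp: two_complex_symmetric_J_def)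
  define a where "a = \<phi> 0"
  define b where "b = \<phi> a"
  have a: "a \<in> \<bbbD>"
    using assms(2) by (force simp: a_def)
  then have b: "b \<in> \<bbbD>"
    using assms(2) unfolding b_def by blast
  \<comment> \<open>Both \<open>J\<close> and the operator fix \<open>kernel 0\<close>, while each
    application of the adjoint moves the base point by \<open>\<phi>\<close>.\<close>
  have "(\<lambda>z. kernel 0 z - 2 * kernel a z + kernel b z) = (\<lambda>z. 0)"
    using S a by (simp add: composition_op_kernel_0[OF assms(2)] J_kernel_0 a_def b_def
        adjoint_op_composition_kernel[OF bd assms(2)] del: mem_ball)
  note E = fun_cong[OF this]
  have ne: "1 - cnj w * z \<noteq> 0" if "w \<in> \<bbbD>" "z \<in> \<bbbD>" for w z
  proof
    assume "1 - cnj w * z = 0"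
    then have "cmod w * cmod z = 1"
      by (metis complex_mod_cnj eq_iff_diff_eq_0 norm_mult norm_one)
    then show False
      using that mult_strict_mono[of "cmod w" 1 "cmod z" 1] by simp
  qed
  \<comment> \<open>The kernel identity with denominators cleared, which \<open>ne\<close>
    permits.\<close>
  have "z * cnj b + z * z * (cnj a * cnj b) = 2 * z * cnj a" if z: "z \<in> \<bbbD>" for z
    using E[of z] ne[OF a z] ne[OF b z] z
    by (simp add: kernel_def divide_simps del: mem_ball) (simp add: algebra_simps)
  \<comment> \<open>Opposite points separate the even part from the odd part: adding the two
    equations leaves only the quadratic coefficient \<open>cnj a * cnj b\<close>. Once it is zero,
    the first equation makes \<open>a\<close> half of \<open>b\<close>, so both vanish.\<close>
  from this[of "1/2"] this[of "-1/2"]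
  have half: "cnj b / 2 + cnj a * cnj b / 4 = cnj a" "- cnj b / 2 + cnj a * cnj b / 4 = - cnj a"
    by simp_all
  have "(cnj b / 2 + cnj a * cnj b / 4) + (- cnj b / 2 + cnj a * cnj b / 4) = 0"
    unfolding half by simp
  then have "cnj a * cnj b = 0"
    by simp
  then have "a = 0"
    using half(1) by auto
  then show ?thesis
    by (simp add: a_def)
qed

subsection \<open>Rotations\<close>

text \<open>The Schwarz lemma applied to \<open>\<phi>\<close> and to its holomorphic inverse gives
  opposite inequalities, so \<open>\<phi>\<close> preserves the modulus and the equality case
  applies.\<close>

lemma disk_automorphism_rotation:
  assumes "disk_automorphism \<phi>" "\<phi> 0 = 0"
  obtains c where "cmod c = 1" "\<And>z. z \<in> \<bbbD> \<Longrightarrow> \<phi> z = c * z"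
proof -
  have hol: "\<phi> holomorphic_on \<bbbD>" and inj: "inj_on \<phi> \<bbbD>" and im: "\<phi> ` \<bbbD> = \<bbbD>"
    using assms(1) by (auto simp: disk_automorphism_def bij_betw_def)
  obtain \<psi> where \<psi>: "\<psi> holomorphic_on \<phi> ` \<bbbD>" "\<And>z. z \<in> \<bbbD> \<Longrightarrow> \<psi> (\<phi> z) = z"
    using holomorphic_has_inverse[OF hol open_ball inj] by metis
  have \<psi>im: "cmod (\<psi> w) < 1" if "cmod w < 1" for w
  proof -
    have "w \<in> \<phi> ` \<bbbD>"
      unfolding im using that by simp
    then obtain z where "w = \<phi> z" "z \<in> \<bbbD>"
      by (rule imageE)
    then show ?thesis
      using \<psi>(2) by simp
  qed
  have \<phi>im: "cmod (\<phi> z) < 1" if "cmod z < 1" for z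
    using that imageI[of z "\<bbbD>" \<phi>] unfolding im by simp
  have "\<psi> 0 = 0"
    using \<psi>(2)[of 0] assms(2) by simp
  then have ge: "cmod (\<psi> (\<phi> z)) \<le> cmod (\<phi> z)" if "cmod z < 1" for z
    using \<psi>(1) that by (intro Schwarz_Lemma) (auto simp: im \<psi>im \<phi>im)
  have le: "cmod (\<phi> z) \<le> cmod z" if "cmod z < 1" for z
    using that by (intro Schwarz_Lemma) (auto simp: hol assms \<phi>im)
  have "cmod (\<phi> z) = cmod z" if "cmod z < 1" for z
    using ge[OF that] le[OF that] \<psi>(2)[of z] that by simp
  \<comment> \<open>The equality case asks for one nonzero point where the modulus is preserved;
    \<open>1/2\<close> is an arbitrary choice.\<close>
  then have "\<exists>c. (\<forall>z. cmod z < 1 \<longrightarrow> \<phi> z = c * z) \<and> cmod c = 1"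
    by (intro Schwarz_Lemma(3)[of \<phi> 0] hol assms \<phi>im disjI1 exI[of _ "1/2"]) (auto simp: norm_divide)
  then show ?thesis
    using that by auto
qed

abbreviation rotation_op :: "complex \<Rightarrow> H2_op"
  where "rotation_op c \<equiv> composition_op ((*) c)"

text \<open>A rotation is diagonal in the monomials, with eigenvalues \<open>c ^ n\<close> of
  modulus 1; the norm and the adjoint are read off from this.\<close>

lemma rotation_op_expands:
  assumes "cmod c = 1" "expands a f"
  shows "expands (\<lambda>n. c ^ n * a n) (rotation_op c f)"
  unfolding expands_def
proof
  fix z assume "z \<in> \<bbbD>"
  then have "(\<lambda>n. a n * (c * z) ^ n) sums f (c * z)"
    using assms by (auto simp: expands_def norm_mult)
  then show "(\<lambda>n. c ^ n * a n * z ^ n) sums rotation_op c f z"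
    using \<open>z \<in> \<bbbD>\<close> by (simp add: composition_op_def power_mult_distrib mult_ac)
qed

lemma rotation_op_in_H2:
  assumes "cmod c = 1" "f \<in> H2"
  shows "rotation_op c f \<in> H2"
proof -
  obtain a where a: "expands a f" "summable (\<lambda>n. (cmod (a n))\<^sup>2)"
    using H2_expands assms(2) .
  then show ?thesis
    using assms(1) by (subst H2_iff[OF rotation_op_expands[OF assms(1) a(1)]])
      (auto simp: composition_op_def norm_mult norm_power)
qed

lemma H2_norm_rotation_op:
  assumes "cmod c = 1" "f \<in> H2"
  shows "H2_norm (rotation_op c f) = H2_norm f"
proof -
  \<comment> \<open>The means agree radius by radius through Parseval, with no substitution in the
    integral.\<close>
  have "circle_mean_sq (rotation_op c f) r = circle_mean_sq f r" if "0 < r" "r < 1" for r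
  proof -
    obtain a where a: "expands a f"
      using H2_expands assms(2) by metis
    show ?thesis
      using circle_mean_sq_sums[OF a that]
        circle_mean_sq_sums[OF rotation_op_expands[OF assms(1) a] that] assms(1)
      by (simp add: norm_mult norm_power sums_unique2)
  qed
  then show ?thesis
    by (simp add: H2_norm_def cong: SUP_cong_simp)
qed

lemma bounded_rotation_op:
  assumes "cmod c = 1"
  shows "bounded_op (rotation_op c)"
proof -
  have "\<exists>K. \<forall>f\<in>H2. H2_norm (rotation_op c f) \<le> K * H2_norm f"
    by (rule exI[of _ 1]) (simp add: H2_norm_rotation_op assms)
  then show ?thesis
    using rotation_op_in_H2[OF assms] by (auto simp: bounded_op_def composition_op_def fun_eq_iff)
qed

text \<open>In the coefficient pairing the eigenvalue \<open>c ^ n\<close> moves to the second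
  argument as its conjugate.\<close>

lemma adjoint_rotation_op:
  assumes "cmod c = 1" "g \<in> H2"
  shows "adjoint_op (rotation_op c) g = rotation_op (cnj c) g"
proof (rule adjoint_op_eqI)
  have c': "cmod (cnj c) = 1"
    using assms(1) by simp
  then show "rotation_op (cnj c) g \<in> H2"
    using assms(2) by (rule rotation_op_in_H2)
  fix f assume f: "f \<in> H2"
  obtain a where a: "expands a f" "summable (\<lambda>n. (cmod (a n))\<^sup>2)"
    using H2_expands f .
  obtain b where b: "expands b g" "summable (\<lambda>n. (cmod (b n))\<^sup>2)"
    using H2_expands assms(2) .
  have "(\<lambda>n. c ^ n * a n * cnj (b n)) sums H2_inner (rotation_op c f) g"
    using a b assms(1)
    by (intro H2_inner_sums rotation_op_expands) (auto simp: norm_mult norm_power)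
  moreover have "(\<lambda>n. a n * cnj (cnj c ^ n * b n)) sums H2_inner f (rotation_op (cnj c) g)"
    using a b c' by (intro H2_inner_sums rotation_op_expands) (auto simp: norm_mult norm_power)
  ultimately show "H2_inner (rotation_op c f) g = H2_inner f (rotation_op (cnj c) g)"
    by (simp add: mult_ac sums_unique2)
qed

lemma normal_rotation_op:
  assumes "cmod c = 1"
  shows "normal_op (rotation_op c)"
  using assms
  by (auto simp: normal_op_def bounded_rotation_op adjoint_rotation_op rotation_op_in_H2)
    (auto simp: composition_op_def norm_mult fun_eq_iff mult_ac)

text \<open>Conjugating by \<open>J\<close> turns rotation by \<open>c\<close> into rotation by
  \<open>cnj c\<close>, which is the adjoint. The three terms are therefore the squared adjoint with
  weights 1, -2 and 1.\<close>

lemma two_complex_symmetric_rotation_op: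
  assumes "cmod c = 1"
  shows "two_complex_symmetric_J (rotation_op c)"
  unfolding two_complex_symmetric_J_def
proof (intro conjI ballI)
  show "bounded_op (rotation_op c)"
    by (rule bounded_rotation_op[OF assms])
  fix f assume f: "f \<in> H2"
  let ?R = "rotation_op (cnj c)"
  have f0: "f z = 0" if "\<not> cmod z < 1" for z
    using f that by (auto simp: H2_def)
  have J1: "J (rotation_op c (J f)) = ?R f"
    using assms f0 by (auto simp: J_def composition_op_def fun_eq_iff norm_mult)
  have J2: "J (rotation_op c (rotation_op c (J f))) = ?R (?R f)"
    using assms f0 by (auto simp: J_def composition_op_def fun_eq_iff norm_mult)
  have "?R f \<in> H2"
    using f assms by (simp add: rotation_op_in_H2)
  then show "(\<lambda>z. J (rotation_op c (rotation_op c (J f))) z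
      - 2 * adjoint_op (rotation_op c) (J (rotation_op c (J f))) z
      + adjoint_op (rotation_op c) (adjoint_op (rotation_op c) f) z) = (\<lambda>z. 0)"
    using f by (simp add: J1 J2 adjoint_rotation_op[OF assms])
qed

theorem theorem1:
  fixes \<phi> :: "complex \<Rightarrow> complex"
  assumes "disk_automorphism \<phi>"
  shows "two_complex_symmetric_J (composition_op \<phi>) \<longleftrightarrow> normal_op (composition_op \<phi>)"
proof -
  have im: "\<phi> ` \<bbbD> \<subseteq> \<bbbD>"
    using assms by (auto simp: disk_automorphism_def bij_betw_def)
  \<comment> \<open>If the origin is fixed, both properties hold; as each of them forces this, the
    equivalence follows.\<close>
  have "two_complex_symmetric_J (composition_op \<phi>) \<and> normal_op (composition_op \<phi>)"
    if "\<phi> 0 = 0"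
  proof -
    obtain c where c: "cmod c = 1" "\<And>z. z \<in> \<bbbD> \<Longrightarrow> \<phi> z = c * z"
      using disk_automorphism_rotation[OF assms \<open>\<phi> 0 = 0\<close>] by blast
    \<comment> \<open>Agreement on the disk is enough for equality of the operators, since
      \<open>composition_op\<close> is zero outside it.\<close>
    then have "composition_op \<phi> = rotation_op c"
      by (auto simp: composition_op_def fun_eq_iff)
    then show ?thesis
      using c(1) by (simp add: normal_rotation_op two_complex_symmetric_rotation_op)
  qed
  then show ?thesis
    using normal_fixes_0[OF _ im] two_complex_symmetric_fixes_0[OF _ im] by blast
qed

end
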